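(* Let $m\ge 4$ be even and let $i$ be a positive integer with $\gcd(m,i)=1$. Define $F':\mathbb{F}_{2^m}\to\mathbb{F}_{2^m}$ by $$F'(x)=x^{2^i+1}+(x^{2^i}+x+1)\,tr(x^{2^i+1}).$$ Then $F'$ is almost perfect nonlinear (APN), and $F'$ is EA-inequivalent to every power function on $\mathbb{F}_{2^m}$.
   Context: $tr(x)=x+x^2+x^4+\dots+x^{2^{m-1}}$ is the absolute trace from $\mathbb{F}_{2^m}$ to $\mathbb{F}_2$. A function $F:\mathbb{F}_{2^m}\to\mathbb{F}_{2^m}$ is almost perfect nonlinear (APN) if for every $a\neq 0$ and every $b$ in $\mathbb{F}_{2^m}$ the equation $F(x+a)+F(x)=b$ has at most $2$ solutions $x\in\mathbb{F}_{2^m}$. A function is affine if it is a linearized polynomial $\sum_j c_jx^{2^j}$ plus a constant. Functions $F,F'$ are EA-equivalent if $F'=A_1\circ F\circ A_2+A$ for some affine permutations $A_1,A_2$ and some affine function $A$. A power function is a map $x\mapsto x^d$ for some integer $d$. *)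

theory Defs
  imports Complex_Main "HOL-Library.Cardinality"
begin

text \<open>
  The field with \<open>2 ^ m\<close> elements is a type \<open>'a :: {finite, field}\<close> with \<open>CARD('a) = 2 ^ m\<close>.
\<close>

definition abs_trace :: "nat \<Rightarrow> 'a :: {finite, field} \<Rightarrow> 'a" where
  "abs_trace m x = (\<Sum>k<m. x ^ (2 ^ k))"

definition apn :: "('a :: {finite, field} \<Rightarrow> 'a) \<Rightarrow> bool" where
  "apn F \<longleftrightarrow> (\<forall>a b. a \<noteq> 0 \<longrightarrow> card {x. F (x + a) + F x = b} \<le> 2)"

definition affine_fun :: "('a :: {finite, field} \<Rightarrow> 'a) \<Rightarrow> bool" where
  "affine_fun A \<longleftrightarrow> (\<exists>n c b. \<forall>x. A x = (\<Sum>j<(n::nat). c j * x ^ (2 ^ j)) + b)"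

definition affine_permutation :: "('a :: {finite, field} \<Rightarrow> 'a) \<Rightarrow> bool" where
  "affine_permutation A \<longleftrightarrow> affine_fun A \<and> bij A"

definition EA_equivalent ::
    "('a :: {finite, field} \<Rightarrow> 'a) \<Rightarrow> ('a \<Rightarrow> 'a) \<Rightarrow> bool" where
  "EA_equivalent F G \<longleftrightarrow>
     (\<exists>A1 A2 A. affine_permutation A1 \<and> affine_permutation A2 \<and> affine_fun A \<and>
        (\<forall>x. G x = A1 (F (A2 x)) + A x))"

text \<open>
  All integer exponents are allowed. At \<open>x = 0\<close> the conventions of \<open>powi\<close> apply:
  the value is \<open>1\<close> for \<open>d = 0\<close> and \<open>0\<close> for \<open>d < 0\<close>, so that on the field with \<open>2 ^ m\<close>
  elements (\<open>m \<ge> 2\<close>) the exponent \<open>-1\<close> gives the same function as \<open>2 ^ m - 2\<close>.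
\<close>

definition power_fun :: "('a :: {finite, field} \<Rightarrow> 'a) \<Rightarrow> bool" where
  "power_fun P \<longleftrightarrow> (\<exists>d :: int. \<forall>x. P x = x powi d)"

end

theory Submission
  imports Defs "HOL-Computational_Algebra.Polynomial"
begin

text \<open>
  Let \<open>q = 2 ^ i\<close>, \<open>G x = x ^ (q + 1)\<close> and \<open>T x = tr (G x)\<close>. Since \<open>tr 1 = 0\<close>, the map
  \<open>x \<mapsto> x + T x\<close> is an involution preserving \<open>T\<close>, and \<open>F' x = G (x + T x)\<close>. With \<open>y = x + T x\<close>, the
  graph of \<open>F'\<close> is the image of the graph of \<open>G\<close> under the linear map \<open>(y, z) \<mapsto> (y + tr z, z)\<close>,
  so \<open>F'\<close> inherits the APN property from \<open>G\<close>.

  For the inequivalence, consider third-order derivatives. Those of \<open>F'\<close> do not all vanish, but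
  those of \<open>tr \<circ> F' = T\<close> do. If \<open>F'\<close> were EA-equivalent to \<open>P x = x powi d\<close>, then the third-order
  derivatives of \<open>P\<close> would not all vanish and would lie in a proper additive subgroup \<open>H\<close> (the image
  of the kernel of the trace). They are permuted by multiplication with powers \<open>y powi d\<close>, so
  \<open>k * w \<in> H\<close> for a fixed \<open>w \<noteq> 0\<close> and all \<open>k\<close> in the additive span of these powers. This span is
  a subfield, hence a proper one, of size at most \<open>2 ^ (m div 2)\<close>. But it contains the values
  of \<open>x \<mapsto> P (x + 1) + P x\<close>, of which there are at least \<open>2 ^ (m - 1)\<close> because \<open>P\<close> is APN.
\<close>

section \<open>Counting in finite fields\<close>

lemma power_card_field:
  fixes x :: "'a :: {finite, field}"
  shows "x ^ CARD('a) = x"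
proof (cases "x = 0")
  case False
  let ?U = "UNIV - {0 :: 'a}"
  have "bij_betw ((*) x) ?U ?U"
    by (rule bij_betw_byWitness[where f' = "\<lambda>y. y / x"]) (use False in auto)
  then have "(\<Prod>y\<in>?U. x * y) = \<Prod>?U"
    by (rule prod.reindex_bij_betw)
  then have "x ^ card ?U * \<Prod>?U = \<Prod>?U"
    by (simp add: prod.distrib)
  then have "x ^ card ?U = 1"
    by simp
  moreover have "CARD('a) = Suc (card ?U)"
    by (simp add: card_Suc_Diff1)
  ultimately show ?thesis
    by (simp only: power_Suc mult_1_right)
qed (simp add: finite_UNIV_card_ge_0)

lemma card_domain_le_two_fibres:
  fixes f :: "'a :: finite \<Rightarrow> 'b"
  assumes "\<And>b. card {x. f x = b} \<le> 2" and "range f \<subseteq> S" and "finite S"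
  shows "CARD('a) \<le> 2 * card S"
proof -
  have "UNIV = (\<Union>b\<in>S. {x. f x = b})"
    using assms(2) by auto
  then have "CARD('a) \<le> (\<Sum>b\<in>S. card {x. f x = b})"
    using card_UN_le[OF assms(3), of "\<lambda>b. {x. f x = b}"] by simp
  also have "\<dots> \<le> (\<Sum>b\<in>S. 2)"
    by (intro sum_mono assms(1))
  finally show ?thesis
    by simp
qed

text \<open>Inverses are powers, so \<open>K\<close> is a subfield. For \<open>t\<close> outside
  \<open>K\<close>, the elements \<open>1\<close> and \<open>t\<close> are independent over
  \<open>K\<close>, which embeds \<open>K \<times> K\<close> into the field.\<close>

lemma card_proper_subfield_square_le:
  fixes K :: "'a :: {finite, field} set"
  assumes one: "1 \<in> K" and diff: "\<And>x y. x \<in> K \<Longrightarrow> y \<in> K \<Longrightarrow> x - y \<in> K"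
    and mult: "\<And>x y. x \<in> K \<Longrightarrow> y \<in> K \<Longrightarrow> x * y \<in> K" and "K \<noteq> UNIV"
  shows "card K * card K \<le> CARD('a)"
proof -
  obtain t where t: "t \<notin> K"
    using \<open>K \<noteq> UNIV\<close> by blast
  have pow: "x ^ n \<in> K" if "x \<in> K" for x n
    using that by (induction n) (auto intro: one mult)
  have inv: "inverse x \<in> K" if "x \<in> K" for x
  proof (cases "x = 0")
    case False
    have "card {0, 1 :: 'a} \<le> CARD('a)"
      by (rule card_mono) auto
    then obtain n where n: "CARD('a) = Suc (Suc n)"
      by (metis card_2_iff zero_neq_one add_2_eq_Suc le_Suc_ex)
    have "x * (x ^ n * x) = x * 1"
      using power_card_field[of x] by (simp add: n mult_ac)
    then have "x ^ n * x = 1"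
      using False by (metis mult_left_cancel)
    then have "inverse x = x ^ n"
      using False by (simp add: field_simps)
    then show ?thesis
      using pow[OF that] by simp
  qed (use that in simp)
  have "inj_on (\<lambda>(a, b). a + b * t) (K \<times> K)"
  proof (rule inj_onI, clarify)
    fix a b a' b'
    assume K: "a \<in> K" "b \<in> K" "a' \<in> K" "b' \<in> K" and eq: "a + b * t = a' + b' * t"
    have "b = b'"
    proof (rule ccontr)
      assume "b \<noteq> b'"
      then have "t = (a' - a) * inverse (b - b')"
        using eq by (simp add: field_simps)
      then show False
        using t K diff mult inv by metis
    qed
    then show "a = a' \<and> b = b'"
      using eq by simp
  qed
  from card_inj_on_le[OF this, of UNIV] show ?thesis
    by (simp add: card_cartesian_product)
qed

lemma card_roots_le:
  fixes p :: "'a :: idom poly"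
  assumes "coeff p n \<noteq> 0" and "degree p \<le> d"
  shows "card {x. poly p x = 0} \<le> d"
proof -
  have "p \<noteq> 0"
    using assms(1) by auto
  then show ?thesis
    using card_poly_roots_bound[of p] assms(2) by linarith
qed

section \<open>Iterated increments and the span of power values\<close>

text \<open>In characteristic 2 sums and differences agree, hence the sum in the derivative.\<close>

definition increment :: "('a :: ab_group_add \<Rightarrow> 'a) \<Rightarrow> 'a \<Rightarrow> 'a \<Rightarrow> 'a" where
  "increment F a x = F (x + a) + F x"

abbreviation increment3 :: "('a :: ab_group_add \<Rightarrow> 'a) \<Rightarrow> 'a \<Rightarrow> 'a \<Rightarrow> 'a \<Rightarrow> 'a \<Rightarrow> 'a" where
  "increment3 F a b c \<equiv> increment (increment (increment F a) b) c"

text \<open>In characteristic 2 every element is its own negative, so this is the additive group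
  generated by the values \<open>y powi d\<close>.\<close>

inductive_set power_span :: "int \<Rightarrow> 'a :: field set" for d where
  zero: "0 \<in> power_span d"
| add_power: "k \<in> power_span d \<Longrightarrow> y powi d + k \<in> power_span d"

lemma power_in_power_span: "y powi d \<in> power_span d"
  using power_span.add_power[OF power_span.zero, of y] by simp

lemma add_in_power_span: "k \<in> power_span d \<Longrightarrow> l \<in> power_span d \<Longrightarrow> k + l \<in> power_span d"
  by (induction k rule: power_span.induct) (auto simp: add.assoc intro: power_span.add_power)

text \<open>A product of two \<open>d\<close>-th powers is again a \<open>d\<close>-th power;
  distributivity extends this to sums.\<close>

lemma mult_in_power_span:
  assumes "k \<in> power_span d" and "l \<in> power_span d"
  shows "k * l \<in> power_span d"
proof -
  have scale: "y powi d * l \<in> power_span d" for y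
    using assms(2)
  proof (induction l rule: power_span.induct)
    case (add_power k z)
    then show ?case
      using power_span.add_power[of "y powi d * k" d "y * z"]
      by (simp add: distrib_left power_int_mult_distrib)
  qed (simp add: power_span.zero)
  show ?thesis
    using assms(1)
    by (induction k rule: power_span.induct)
      (auto simp: distrib_right intro: power_span.zero add_in_power_span scale)
qed

lemma increment3_scale_power:
  "increment3 (\<lambda>x. x powi d) (y * a) (y * b) (y * c) (y * x :: 'a :: field) =
   y powi d * increment3 (\<lambda>x. x powi d) a b c x"
  by (simp add: increment_def power_int_mult_distrib flip: distrib_left)

section \<open>Characteristic 2 and the absolute trace\<close>

locale binary_field =
  fixes ty :: "'a :: {finite, field} itself" and m :: nat
  assumes card_field: "CARD('a) = 2 ^ m"
begin

lemma m_pos: "m > 0"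
proof (rule ccontr)
  assume "\<not> m > 0"
  then have "card {0, 1 :: 'a} \<le> 1"
    using card_mono[of UNIV "{0, 1 :: 'a}"] card_field by simp
  then show False
    by simp
qed

lemma power_field: "x ^ (2 ^ m) = (x :: 'a)"
  using power_card_field[of x] by (simp add: card_field)

lemma add_self [simp]: "x + x = (0 :: 'a)"
proof -
  \<comment> \<open>The even exponent makes \<open>(- 1) ^ (2 ^ m)\<close> equal to 1, while
    \<open>power_field\<close> makes it -1.\<close>
  have "even ((2 :: nat) ^ m)"
    using m_pos by simp
  then have "(- 1 :: 'a) = 1"
    using power_field[of "- 1"] by simp
  then have "x * 1 + x * (- 1) = x + x"
    by simp
  then show ?thesis
    by simp
qed

lemma add_self_left [simp]: "x + (x + y) = (y :: 'a)"
  by (metis add.assoc add_self add_0_left)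

lemma add_eq_0_iff_eq: "x + y = 0 \<longleftrightarrow> x = (y :: 'a)"
  using add_left_cancel[of x x y] by auto

lemma minus_eq_add: "x - y = x + (y :: 'a)"
  by (simp add: diff_eq_eq add.assoc)

lemma power2_pow_add: "(x + y) ^ (2 ^ n) = x ^ (2 ^ n) + (y :: 'a) ^ (2 ^ n)"
proof (induction n)
  case (Suc n)
  have sq: "(u + v) ^ 2 = u ^ 2 + v ^ 2" for u v :: 'a
    by (simp add: power2_sum mult_2)
  show ?case
    by (simp only: power_Suc2 power_mult Suc sq)
qed simp

lemma power2_pow_sum: "(\<Sum>k\<in>A. f k) ^ (2 ^ n) = (\<Sum>k\<in>A. (f k :: 'a) ^ (2 ^ n))"
  by (induction A rule: infinite_finite_induct) (simp_all add: power2_pow_add)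

abbreviation tr :: "'a \<Rightarrow> 'a" where
  "tr \<equiv> abs_trace m"

lemma tr_add: "tr (x + y) = tr x + tr y"
  by (simp add: abs_trace_def power2_pow_add sum.distrib)

lemma tr_0 [simp]: "tr 0 = 0"
  by (simp add: abs_trace_def power_0_left)

text \<open>Squaring permutes the terms of the trace cyclically, as
  \<open>x ^ (2 ^ m) = x\<close>.\<close>

lemma tr_square: "tr (x ^ 2) = tr x"
proof -
  have "x + (\<Sum>k<m. x ^ (2 ^ Suc k)) = (\<Sum>k<Suc m. x ^ (2 ^ k))"
    by (subst sum.lessThan_Suc_shift) simp
  also have "\<dots> = x + (\<Sum>k<m. x ^ (2 ^ k))"
    by (simp add: power_field add.commute)
  finally show ?thesis
    by (simp add: abs_trace_def power_mult)
qed

lemma tr_power2_pow: "tr (x ^ (2 ^ n)) = tr x"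
  by (induction n) (simp_all add: power_Suc2 power_mult tr_square del: power_Suc)

lemma tr_01: "tr x = 0 \<or> tr x = 1"
proof -
  have "(tr x) ^ (2 ^ 1) = tr (x ^ (2 ^ 1))"
    unfolding abs_trace_def power2_pow_sum by (simp add: mult.commute flip: power_mult)
  then have "tr x * tr x = tr x * 1"
    by (simp add: power2_eq_square tr_square[unfolded power2_eq_square])
  then show ?thesis
    by (metis mult_left_cancel)
qed

lemma tr_1: "even m \<Longrightarrow> tr 1 = 0"
proof -
  assume "even m"
  then obtain k where "m = k + k"
    by (metis evenE mult_2)
  then show ?thesis
    by (simp add: abs_trace_def)
qed

text \<open>As a polynomial, the trace has degree at most \<open>2 ^ (m - 1)\<close> and linear
  coefficient 1, so it cannot vanish at all \<open>2 ^ m\<close> elements.\<close>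

lemma ex_tr_eq_1: "\<exists>x. tr x = 1"
proof (rule ccontr)
  assume "\<nexists>x. tr x = 1"
  then have "tr x = 0" for x
    using tr_01 by blast
  define p where "p = (\<Sum>k<m. monom (1 :: 'a) (2 ^ k))"
  have "poly p x = tr x" for x
    by (simp add: p_def poly_sum poly_monom abs_trace_def)
  moreover have "coeff p 1 \<noteq> 0"
  proof -
    have "coeff p 1 = (\<Sum>k<m. if k = 0 then 1 else 0)"
      unfolding p_def coeff_sum by (intro sum.cong) auto
    then show ?thesis
      using m_pos by simp
  qed
  moreover have "degree p \<le> 2 ^ (m - 1)"
    unfolding p_def
  proof (rule degree_sum_le)
    fix k assume "k \<in> {..<m}"
    then show "degree (monom (1 :: 'a) (2 ^ k)) \<le> 2 ^ (m - 1)"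
      by (simp add: degree_monom_eq)
  qed simp
  ultimately have "CARD('a) \<le> 2 ^ (m - 1)"
    using card_roots_le[of p 1 "2 ^ (m - 1)"] \<open>\<And>x. tr x = 0\<close> by simp
  then show False
    using card_field m_pos by simp
qed

lemma tr_nondegenerate:
  assumes "\<And>x. tr (v * x) = 0"
  shows "v = 0"
proof (rule ccontr)
  assume "v \<noteq> 0"
  obtain x where "tr x = 1"
    using ex_tr_eq_1 by blast
  then show False
    using assms[of "x / v"] \<open>v \<noteq> 0\<close> by simp
qed

lemma fixed_power2_pow_mult:
  assumes "x ^ (2 ^ n) = (x :: 'a)"
  shows "x ^ (2 ^ (n * k)) = x"
proof (induction k)
  case (Suc k)
  have "x ^ (2 ^ (n * Suc k)) = (x ^ (2 ^ n)) ^ (2 ^ (n * k))"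
    by (simp add: power_add power_mult)
  then show ?case
    using assms Suc by simp
qed simp

text \<open>Iterating shows that \<open>x\<close> is fixed for the exponents \<open>n * k\<close>
  and \<open>m * l\<close>, which Bezout makes differ by \<open>gcd n m\<close>.\<close>

lemma fixed_power2_pow_gcd:
  assumes "n \<noteq> 0" and "x ^ (2 ^ n) = (x :: 'a)"
  shows "x ^ (2 ^ gcd n m) = x"
proof -
  obtain k l where "n * k = m * l + gcd n m"
    using bezout_nat[OF assms(1), of m] by blast
  then have "x ^ (2 ^ (n * k)) = (x ^ (2 ^ (m * l))) ^ (2 ^ gcd n m)"
    by (simp add: power_add power_mult)
  then show ?thesis
    using fixed_power2_pow_mult[OF assms(2)] fixed_power2_pow_mult[OF power_field] by simp
qed

section \<open>EA-equivalence and third-order increments\<close>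

text \<open>The summand \<open>A 0\<close> restores the constant term, which cancels between
  \<open>A x\<close> and \<open>A y\<close>.\<close>

lemma affine_fun_add:
  assumes "affine_fun (A :: 'a \<Rightarrow> 'a)"
  shows "A (x + y) = A x + A y + A 0"
proof -
  obtain n c b where A: "\<And>x. A x = (\<Sum>j<(n::nat). c j * x ^ (2 ^ j)) + b"
    using assms unfolding affine_fun_def by blast
  show ?thesis
    by (simp add: A power2_pow_add distrib_left sum.distrib power_0_left add_ac)
qed

lemma apn_EA_equivalent:
  assumes "apn (F :: 'a \<Rightarrow> 'a)" and "EA_equivalent F P"
  shows "apn P"
  unfolding apn_def
proof (intro allI impI)
  fix a b :: 'a
  assume "a \<noteq> 0"
  obtain A1 A2 A where A1: "affine_fun A1" "bij A1" and A2: "affine_fun A2" "bij A2"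
    and A: "affine_fun A" and P: "\<And>x. P x = A1 (F (A2 x)) + A x"
    using assms(2) unfolding EA_equivalent_def affine_permutation_def by blast
  define a' where "a' = A2 a + A2 0"
  have A2_add: "A2 (x + a) = A2 x + a'" for x
    using affine_fun_add[OF A2(1), of x a] by (simp add: a'_def add_ac)
  have "a' \<noteq> 0"
    using \<open>a \<noteq> 0\<close> bij_is_inj[OF A2(2)] by (auto simp: a'_def add_eq_0_iff_eq inj_eq)
  \<comment> \<open>In \<open>P (x + a) + P x = b\<close> the affine terms collapse to constants;
    \<open>c\<close> is the resulting value of the increment of \<open>F\<close>.\<close>
  define c where "c = inv A1 (b + A a + A 0 + A1 0)"
  have "A2 ` {x. P (x + a) + P x = b} \<subseteq> {y. F (y + a') + F y = c}"
  proof (rule image_subsetI, rule CollectI)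
    fix x
    assume "x \<in> {x. P (x + a) + P x = b}"
    then have "b = P (x + a) + P x"
      by simp
    then have "b + A a + A 0 + A1 0 = A1 (F (A2 x + a') + F (A2 x))"
      using affine_fun_add[OF A, of x a] affine_fun_add[OF A1(1), of "F (A2 x + a')" "F (A2 x)"]
      by (simp only: P A2_add) (simp add: add_ac)
    then show "F (A2 x + a') + F (A2 x) = c"
      by (simp add: c_def bij_is_inj[OF A1(2)])
  qed
  then have "card {x. P (x + a) + P x = b} \<le> card {y. F (y + a') + F y = c}"
    using bij_is_inj[OF A2(2)] by (intro card_inj_on_le[of A2]) (auto intro: inj_on_subset)
  also have "\<dots> \<le> 2"
    using assms(1) \<open>a' \<noteq> 0\<close> unfolding apn_def by blast
  finally show "card {x. P (x + a) + P x = b} \<le> 2" .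
qed

lemma increment_comp:
  fixes L A A2 F :: "'a \<Rightarrow> 'a"
  assumes "\<And>u v. L (u + v) = L u + L v"
    and "\<And>x y. A2 (x + y) = A2 x + A2 y + A2 0" and "\<And>x y. A (x + y) = A x + A y + A 0"
  shows "increment (\<lambda>x. L (F (A2 x)) + A x) a =
    (\<lambda>x. L (increment F (A2 a + A2 0) (A2 x)) + (A a + A 0))"
  using assms(2,3)[of _ a] by (simp add: increment_def assms(1) add_ac fun_eq_iff)

text \<open>The first increment turns the affine summand \<open>A\<close> into a constant and the
  second removes it. Directions are mapped by the linear part of \<open>A2\<close>.\<close>

lemma increment3_comp:
  fixes L A A2 F :: "'a \<Rightarrow> 'a"
  assumes "\<And>u v. L (u + v) = L u + L v"
    and "\<And>x y. A2 (x + y) = A2 x + A2 y + A2 0" and "\<And>x y. A (x + y) = A x + A y + A 0"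
  shows "increment3 (\<lambda>x. L (F (A2 x)) + A x) a b c x =
    L (increment3 F (A2 a + A2 0) (A2 b + A2 0) (A2 c + A2 0) (A2 x))"
proof -
  have const: "increment (\<lambda>x. L (H (A2 x)) + k) a =
      (\<lambda>x. L (increment H (A2 a + A2 0) (A2 x)) + 0)" for H a and k :: 'a
    using increment_comp[where A = "\<lambda>_. k", OF assms(1,2)] by simp
  show ?thesis
    unfolding increment_comp[OF assms] const by simp
qed

lemma not_EA_equivalent_power_fun:
  fixes F P :: "'a \<Rightarrow> 'a"
  assumes "m > 2" and "apn F"
    and tr_incr: "\<And>a b c x. tr (increment3 F a b c x) = 0"
    and nonzero: "increment3 F a\<^sub>0 b\<^sub>0 c\<^sub>0 x\<^sub>0 \<noteq> 0"
    and "power_fun P"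
  shows "\<not> EA_equivalent F P"
proof
  assume EA: "EA_equivalent F P"
  then have "apn P"
    using \<open>apn F\<close> apn_EA_equivalent by blast
  obtain d where d: "P = (\<lambda>x. x powi d)"
    using \<open>power_fun P\<close> unfolding power_fun_def by blast
  define K where "K = (power_span d :: 'a set)"
  obtain A1 A2 A where A1: "affine_fun A1" "bij A1" and A2: "affine_fun A2" "bij A2"
    and A: "affine_fun A" and P: "\<And>x. P x = A1 (F (A2 x)) + A x"
    using EA unfolding EA_equivalent_def affine_permutation_def by blast
  \<comment> \<open>\<open>L\<close> is the linear part of \<open>A1\<close>; the constant
    \<open>A1 0\<close> moves into the affine summand.\<close>
  define L where "L = (\<lambda>w. A1 w + A1 0)"
  have L_add: "L (u + v) = L u + L v" for u v
    using affine_fun_add[OF A1(1), of u v] by (simp add: L_def add_ac)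
  have L_0: "L 0 = 0"
    by (simp add: L_def)
  have L_inj: "L u = L v \<longleftrightarrow> u = v" for u v
    by (simp add: L_def inj_eq[OF bij_is_inj[OF A1(2)]])
  have P_L: "P = (\<lambda>x. L (F (A2 x)) + (A x + A1 0))"
    by (simp add: P L_def add_ac fun_eq_iff)
  have incr_P: "increment3 P a b c x =
      L (increment3 F (A2 a + A2 0) (A2 b + A2 0) (A2 c + A2 0) (A2 x))" for a b c x
    unfolding P_L
    using affine_fun_add[OF A] by (intro increment3_comp L_add affine_fun_add[OF A2(1)]) (simp add: add_ac)
  define H where "H = L ` {w. tr w = 0}"
  have H_add: "u + v \<in> H" if "u \<in> H" "v \<in> H" for u v
    using that by (auto simp: H_def tr_add L_add[symmetric])
  have H_0: "0 \<in> H"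
    unfolding H_def by (rule image_eqI[of _ _ 0]) (simp_all add: L_0)
  have incr_H: "increment3 P a b c x \<in> H" for a b c x
    by (simp add: incr_P H_def tr_incr)
  have K_H: "k * increment3 P a b c x \<in> H" if "k \<in> K" for k a b c x
    using that unfolding K_def
  proof (induction k rule: power_span.induct)
    case (add_power k y)
    have "y powi d * increment3 P a b c x \<in> H"
      using incr_H[of "y * a" "y * b" "y * c" "y * x"] by (simp add: d increment3_scale_power)
    then show ?case
      using H_add add_power.IH by (simp add: distrib_right)
  qed (simp add: H_0)
  have A2_surj: "\<exists>a. A2 a + A2 0 = a'" for a'
  proof -
    obtain a where "A2 a = a' + A2 0"
      using bij_is_surj[OF A2(2)] by (metis surjD)
    then have "A2 a + A2 0 = a'"
      by (simp add: add.assoc)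
    then show ?thesis ..
  qed
  obtain a b c x where abcx: "A2 a + A2 0 = a\<^sub>0" "A2 b + A2 0 = b\<^sub>0" "A2 c + A2 0 = c\<^sub>0" "A2 x = x\<^sub>0"
    using A2_surj bij_is_surj[OF A2(2)] by (metis surjD)
  have w: "increment3 P a b c x \<noteq> 0"
    using nonzero L_inj[of _ 0] by (simp add: incr_P abcx L_0)
  have "K \<noteq> UNIV"
  proof
    assume "K = UNIV"
    obtain z where z: "tr z = 1"
      using ex_tr_eq_1 by blast
    \<comment> \<open>If \<open>K\<close> were everything, a suitable multiplier would carry the
      nonzero increment to \<open>L z\<close>, which lies outside \<open>H\<close> because
      \<open>L\<close> is injective.\<close>
    have "L z \<in> H"
      using K_H[of "L z / increment3 P a b c x" a b c x] w \<open>K = UNIV\<close> by simp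
    then show False
      using z by (auto simp: H_def L_inj)
  qed
  then have "card K * card K \<le> CARD('a)"
    using power_in_power_span[of 1 d] unfolding K_def
    by (intro card_proper_subfield_square_le)
      (simp_all add: minus_eq_add add_in_power_span mult_in_power_span)
  then have card_K: "card K * card K \<le> 2 ^ m"
    by (simp add: card_field)
  have "range (\<lambda>x. P (x + 1) + P x) \<subseteq> K"
    by (auto simp: d K_def intro: add_in_power_span power_in_power_span)
  then have "2 ^ m \<le> 2 * card K"
    using \<open>apn P\<close> card_domain_le_two_fibres[of "\<lambda>x. P (x + 1) + P x" K]
    by (simp add: apn_def card_field)
  \<comment> \<open>Squaring this lower bound makes it comparable with the upper bound on
    \<open>card K * card K\<close>.\<close>
  then have "2 ^ m * 2 ^ m \<le> (2 * card K) * (2 * card K)"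
    by (intro mult_mono) simp_all
  also have "\<dots> \<le> 4 * 2 ^ m"
    using card_K by simp
  finally have "(2 :: nat) ^ m \<le> 2 ^ 2"
    by simp
  then have "m \<le> 2"
    by (rule power_le_imp_le_exp[rotated]) simp
  then show False
    using \<open>m > 2\<close> by simp
qed

end

section \<open>The Gold function and the APN property of \<open>F\<close>\<close>

locale gold_setting = binary_field ty m for ty :: "'a :: {finite, field} itself" and m +
  fixes i :: nat
  assumes m_ge: "m \<ge> 4" and even_m: "even m" and i_pos: "i > 0" and coprime: "gcd m i = 1"
begin

definition G :: "'a \<Rightarrow> 'a" where
  "G x = x ^ (2 ^ i + 1)"

text \<open>The symmetric biadditive form that polarizes \<open>G\<close>.\<close>

definition C :: "'a \<Rightarrow> 'a \<Rightarrow> 'a" where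
  "C x y = x ^ (2 ^ i) * y + x * y ^ (2 ^ i)"

text \<open>This is \<open>C x 1\<close>, so \<open>M x + 1\<close> is the change of
  \<open>G\<close> from \<open>x\<close> to \<open>x + 1\<close>.\<close>

definition M :: "'a \<Rightarrow> 'a" where
  "M x = x ^ (2 ^ i) + x"

definition T :: "'a \<Rightarrow> 'a" where
  "T x = tr (G x)"

text \<open>The polar form of the quadratic form \<open>T\<close> over the field with two
  elements.\<close>

definition B :: "'a \<Rightarrow> 'a \<Rightarrow> 'a" where
  "B x y = tr (C x y)"

definition F :: "'a \<Rightarrow> 'a" where
  "F x = G x + (M x + 1) * T x"

lemma G_0 [simp]: "G 0 = 0" and M_0 [simp]: "M 0 = 0" and T_0 [simp]: "T 0 = 0"
  by (simp_all add: G_def M_def T_def power_0_left)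

lemma G_add: "G (x + y) = G x + G y + C x y"
  by (simp add: G_def C_def power2_pow_add algebra_simps)

lemma C_add_left: "C (x + y) z = C x z + C y z" and C_add_right: "C z (x + y) = C z x + C z y"
  by (simp_all add: C_def power2_pow_add algebra_simps)

lemma M_add: "M (x + y) = M x + M y"
  by (simp add: M_def power2_pow_add add_ac)

lemma T_add: "T (x + y) = T x + T y + B x y"
  by (simp add: T_def B_def G_add tr_add)

lemma B_add_left: "B (x + y) z = B x z + B y z" and B_add_right: "B z (x + y) = B z x + B z y"
  by (simp_all add: B_def C_add_left C_add_right tr_add)

lemma T_01: "T x = 0 \<or> T x = 1" and B_01: "B x y = 0 \<or> B x y = 1"
  by (simp_all add: T_def B_def tr_01)

text \<open>Frobenius invariance of the trace gives \<open>B x 1 = 0\<close>, and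
  \<open>T 1 = tr 1 = 0\<close> since \<open>m\<close> is even.\<close>

lemma T_add_1: "T (x + 1) = T x"
  using tr_power2_pow[of x i] tr_1[OF even_m]
  by (simp add: T_add) (simp add: T_def B_def G_def C_def tr_add)

lemma F_eq: "F x = G (x + T x)"
proof -
  have "G (x + 1) = G x + (M x + 1)"
    unfolding G_add by (simp add: G_def C_def M_def add_ac)
  then show ?thesis
    using T_01[of x] by (auto simp: F_def)
qed

lemma T_shift: "T (x + T x) = T x"
  using T_01[of x] T_add_1[of x] by auto

lemma fixed_points: "z ^ (2 ^ i) = z \<Longrightarrow> z = 0 \<or> z = (1 :: 'a)"
proof -
  assume "z ^ (2 ^ i) = z"
  then have "z ^ (2 ^ gcd i m) = z"
    using fixed_power2_pow_gcd i_pos by blast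
  then have "z * z = z * 1"
    using coprime by (simp add: gcd.commute power2_eq_square)
  then show ?thesis
    by (metis mult_left_cancel)
qed

text \<open>The hypotheses reduce to \<open>C e u = 0\<close>, which makes \<open>u / e\<close> a
  fixed point of the \<open>2 ^ i\<close>-th power. The four-point form suits \<open>\<phi>\<close>
  below, which need not preserve differences.\<close>

lemma gold_apn:
  assumes "y1 + y2 + y3 + y4 = 0" and "G y1 + G y2 + G y3 + G y4 = 0" and "y1 \<noteq> y2"
  shows "y1 = y3 \<or> y1 = y4"
proof -
  define e where "e = y1 + y2"
  define u where "u = y2 + y4"
  have e: "e \<noteq> 0"
    using assms(3) by (simp add: e_def add_eq_0_iff_eq)
  have y1: "y1 = y2 + e"
    by (simp add: e_def add_ac)
  have y4: "y4 = y2 + u"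
    by (simp add: u_def)
  have "y3 + (y1 + y2 + y4) = 0"
    using assms(1) by (simp only: add_ac)
  then have y3: "y3 = y2 + u + e"
    by (simp add: add_eq_0_iff_eq y1 y4 add_ac)
  have "C e u = 0"
    using assms(2) by (simp add: y1 y3 y4 G_add C_add_right add_ac)
  then have "(u / e) ^ (2 ^ i) = u / e"
    using e by (simp add: C_def add_eq_0_iff_eq power_divide field_simps)
  then have "u / e = 0 \<or> u / e = 1"
    by (rule fixed_points)
  then have "u = 0 \<or> u = e"
    using e by auto
  then show ?thesis
    by (auto simp: y1 y3 y4 add.assoc)
qed

lemma apn_F: "apn F"
  unfolding apn_def
proof (intro allI impI)
  fix a b :: 'a
  assume "a \<noteq> 0"
  define \<phi> where "\<phi> = (\<lambda>x. x + T x)"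
  have F: "F x = G (\<phi> x)" for x
    by (simp add: F_eq \<phi>_def)
  \<comment> \<open>The correction depends on \<open>G (\<phi> x)\<close> alone and is additive in
    it, so the inverse acts linearly on the graph of \<open>G\<close>.\<close>
  have \<phi>_inverse: "\<phi> x + tr (G (\<phi> x)) = x" for x
    using T_shift[of x] by (simp add: \<phi>_def T_def add.assoc)
  have \<phi>_eq: "\<phi> x = \<phi> y \<longleftrightarrow> x = y" for x y
    by (metis \<phi>_inverse)
  have cases: "y = x \<or> y = x + a" if "F (x + a) + F x = b" "F (y + a) + F y = b" for x y
  proof -
    have "F (x + a) + F x + (F (y + a) + F y) = 0"
      by (simp add: that)
    then have sumG: "G (\<phi> (x + a)) + G (\<phi> x) + G (\<phi> (y + a)) + G (\<phi> y) = 0"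
      by (simp add: F add_ac)
    let ?s = "\<phi> (x + a) + \<phi> x + \<phi> (y + a) + \<phi> y"
    \<comment> \<open>Adding the trace of the vanishing sum turns each summand into its preimage
      under \<open>\<phi>\<close>; the four preimages cancel.\<close>
    have "?s = ?s + tr (G (\<phi> (x + a)) + G (\<phi> x) + G (\<phi> (y + a)) + G (\<phi> y))"
      by (simp add: sumG)
    also have "\<dots> = (\<phi> (x + a) + tr (G (\<phi> (x + a)))) + (\<phi> x + tr (G (\<phi> x))) +
        (\<phi> (y + a) + tr (G (\<phi> (y + a)))) + (\<phi> y + tr (G (\<phi> y)))"
      by (simp add: tr_add add_ac)
    also have "\<dots> = 0"
      by (simp add: \<phi>_inverse add_ac)
    finally have "\<phi> (x + a) = \<phi> (y + a) \<or> \<phi> (x + a) = \<phi> y"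
      using sumG \<open>a \<noteq> 0\<close> by (intro gold_apn[of _ "\<phi> x"]) (simp_all add: \<phi>_eq)
    then show ?thesis
      by (auto simp: \<phi>_eq)
  qed
  show "card {x. F (x + a) + F x = b} \<le> 2"
  proof (cases "{x. F (x + a) + F x = b} = {}")
    case False
    then obtain x where "F (x + a) + F x = b"
      by blast
    then have "{x. F (x + a) + F x = b} \<subseteq> {x, x + a}"
      using cases by blast
    then have "card {x. F (x + a) + F x = b} \<le> card {x, x + a}"
      by (intro card_mono) auto
    also have "\<dots> \<le> 2"
      by (simp add: card_insert_if)
    finally show ?thesis .
  qed (simp only: card.empty)
qed

section \<open>Third-order increments of \<open>F\<close>\<close>

lemma tr_F: "tr (F x) = T x"
  using T_shift[of x] by (simp add: F_eq T_def)

lemma tr_increment3_F: "tr (increment3 F a b c x) = 0"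
  by (simp add: increment_def tr_add tr_F) (simp add: T_add B_add_left B_add_right add_ac)

text \<open>Only the cubic part \<open>M x * T x\<close> survives three increments, leaving its
  polarization.\<close>

lemma increment3_F:
  "increment3 F a b c 0 = M a * B b c + M b * B a c + M c * B a b"
  by (simp add: increment_def F_def)
    (simp add: G_add C_add_left C_add_right M_add T_add B_add_left B_add_right algebra_simps)

text \<open>
  Applying Frobenius to one of its two terms gives \<open>B b c = tr ((b ^ (q ^ 2) + b) * c ^ q)\<close>, so the
  radical of \<open>B\<close> is contained in the subfield with 4 elements.
\<close>

lemma ex_B_eq_1: "\<exists>b c. B b c = 1"
proof (rule ccontr)
  assume "\<nexists>b c. B b c = 1"
  then have B_0: "B b c = 0" for b c
    using B_01 by blast
  have "b ^ 4 = b" for b :: 'a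
  proof -
    let ?v = "(b ^ (2 ^ i)) ^ (2 ^ i) + b"
    have "tr (?v * x) = 0" for x
    proof -
      have "inj (\<lambda>y :: 'a. y ^ (2 ^ i))"
      proof (rule injI)
        fix y z :: 'a
        assume "y ^ (2 ^ i) = z ^ (2 ^ i)"
        then have "(y + z) ^ (2 ^ i) = 0"
          by (simp add: power2_pow_add)
        then show "y = z"
          by (simp add: add_eq_0_iff_eq)
      qed
      then obtain c where c: "x = c ^ (2 ^ i)"
        by (metis finite_UNIV_inj_surj finite surjD)
      have "tr (?v * x) = tr ((b ^ (2 ^ i) * c) ^ (2 ^ i)) + tr (b * c ^ (2 ^ i))"
        by (simp add: c distrib_right power_mult_distrib tr_add)
      also have "\<dots> = B b c"
        by (simp add: tr_power2_pow B_def C_def tr_add)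
      finally show ?thesis
        by (simp add: B_0)
    qed
    then have "?v = 0"
      by (rule tr_nondegenerate)
    then have "b ^ (2 ^ (2 * i)) = b"
      by (simp add: add_eq_0_iff_eq mult_2 power_add power_mult)
    then have "b ^ (2 ^ gcd (2 * i) m) = b"
      using fixed_power2_pow_gcd[of "2 * i" b] i_pos by simp
    moreover have "gcd (2 * i) m = 2"
    proof -
      obtain k where k: "m = 2 * k"
        using even_m by blast
      have "coprime (2 * k) i"
        using coprime by (simp only: k coprime_iff_gcd_eq_1)
      then have "gcd i k = 1"
        by (intro coprime_imp_gcd_eq_1) (simp add: coprime_commute)
      then show ?thesis
        by (simp add: k gcd.commute gcd_mult_distrib_nat[symmetric])
    qed
    ultimately show ?thesis
      by simp
  qed
  then have "poly (monom 1 4 + monom 1 1) b = 0" for b :: 'a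
    by (simp add: poly_monom)
  moreover have "degree (monom 1 4 + monom 1 1 :: 'a poly) \<le> 4"
    by (intro degree_add_le) (simp_all add: degree_monom_eq)
  ultimately have "CARD('a) \<le> 4"
    using card_roots_le[of "monom 1 4 + monom 1 1 :: 'a poly" 4 4] by simp
  moreover have "(2 :: nat) ^ 4 \<le> 2 ^ m"
    using m_ge by (intro power_increasing) simp_all
  ultimately show False
    by (simp add: card_field)
qed

text \<open>
  If all these values vanished, then choosing \<open>B b c = 1\<close> would put every \<open>M a\<close> into the span of
  \<open>M b\<close> and \<open>M c\<close>; but \<open>M\<close> is two-to-one on a field with at least 16 elements.
\<close>

lemma increment3_F_nonzero: "\<exists>a b c. increment3 F a b c 0 \<noteq> 0"
proof (rule ccontr)
  assume "\<not> ?thesis"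
  then have zero: "M a * B b c + M b * B a c + M c * B a b = 0" for a b c
    by (simp add: increment3_F)
  obtain b c where bc: "B b c = 1"
    using ex_B_eq_1 by blast
  let ?S = "{0, M b, M c, M b + M c}"
  have "M a \<in> ?S" for a
  proof -
    have "M a = M b * B a c + M c * B a b"
      using zero[of a b c] by (simp add: bc add.assoc add_eq_0_iff_eq)
    then show ?thesis
      using B_01[of a b] B_01[of a c] by auto
  qed
  moreover have "card {a. M a = v} \<le> 2" for v
  proof (cases "{a. M a = v} = {}")
    case False
    then obtain a where a: "M a = v"
      by blast
    have "x = a \<or> x = a + 1" if "M x = v" for x
    proof -
      have "M (x + a) = 0"
        by (simp add: M_add a that)
      then have "x + a = 0 \<or> x + a = 1"
        by (intro fixed_points) (simp add: M_def add_eq_0_iff_eq)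
      then show ?thesis
        by (metis add_self_left add.commute add_0_right)
    qed
    then have "{a. M a = v} \<subseteq> {a, a + 1}"
      by blast
    then have "card {a. M a = v} \<le> card {a, a + 1}"
      by (intro card_mono) auto
    then show ?thesis
      by simp
  qed (simp only: card.empty)
  ultimately have "CARD('a) \<le> 2 * card ?S"
    by (intro card_domain_le_two_fibres[of M]) auto
  moreover have "card ?S \<le> 4"
    using card_insert_le_m1[of 4 "{M b, M c, M b + M c}" 0] by (simp add: card_insert_if)
  moreover have "(2 :: nat) ^ 4 \<le> 2 ^ m"
    using m_ge by (intro power_increasing) simp_all
  ultimately show False
    by (simp add: card_field)
qed

end

theorem theorem2:
  fixes m i :: nat
    and F' :: "'a :: {finite, field} \<Rightarrow> 'a"
  assumes "CARD('a) = 2 ^ m"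
    and "m \<ge> 4" and "even m"
    and "i > 0" and "gcd m i = 1"
    and "\<And>x. F' x = x ^ (2 ^ i + 1) + (x ^ (2 ^ i) + x + 1) * abs_trace m (x ^ (2 ^ i + 1))"
  shows "apn F' \<and> (\<forall>P. power_fun P \<longrightarrow> \<not> EA_equivalent F' P)"
proof -
  interpret gold_setting "TYPE('a)" m i
    by standard (fact assms)+
  have F': "F' = F"
    by (simp add: fun_eq_iff assms(6) F_def G_def M_def T_def)
  obtain a b c where "increment3 F a b c 0 \<noteq> 0"
    using increment3_F_nonzero by blast
  then have "\<not> EA_equivalent F P" if "power_fun P" for P
    using not_EA_equivalent_power_fun[OF _ apn_F tr_increment3_F _ that] m_ge by simp
  then show ?thesis
    using apn_F by (simp add: F')
qed

end
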